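(* Let $\mathcal{B},\mathcal{B}'$ be integer matrices that are $\mathcal{A}$-graded by $\phi$ and $\phi'$, with compatible additive preorders $\succeq_\times,\succeq_{\mathcal{B}},\succeq_{\mathcal{B}'},\succeq_{\mathcal{A}}$ (as specified in the context). Let $\mathcal{G}$ be a $\succeq_{\mathcal{A}}$-Gröbner basis of $\xi(\mathcal{F}(\mathcal{B}\times_{\mathcal{A}}\mathcal{B}'))$, and let $\mathcal{M}\subset\ker_{\mathbb{Z}}\mathcal{B}$ and $\mathcal{M}'\subset\ker_{\mathbb{Z}}\mathcal{B}'$ be an $(\mathcal{F}(\mathcal{B}),\phi,\succeq_{\mathcal{B}})$-lift and an $(\mathcal{F}(\mathcal{B}'),\phi',\succeq_{\mathcal{B}'})$-lift of $\mathcal{G}$, respectively. Then $\operatorname{Glues}(\mathcal{M},\mathcal{M}')$ is an $(\mathcal{F}(\mathcal{B}\times_{\mathcal{A}}\mathcal{B}'),\xi,\succeq_\times)$-lift of $\mathcal{G}$.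
   Context: $\mathbb{N}=\{0,1,\dots\}$. For an integer matrix $\mathcal{B}$ with $n$ columns, $F(\mathcal{B},b)=\{v\in\mathbb{N}^n:\mathcal{B}v=b\}$ and $\mathcal{F}(\mathcal{B})$ is the collection of all these fibers. For a linear map $\chi$ and a family $\mathcal{F}$, $\chi(\mathcal{F})=\{\chi(F):F\in\mathcal{F}\}$. Toric fiber product: let $\mathcal{A}$ be an integer matrix with $t$ columns, $\mathcal{B}=(b_1,\dots,b_n)$, $\mathcal{B}'=(b'_1,\dots,b'_{n'})$. Surjections $\phi:[n]\to[t]$, $\phi':[n']\to[t]$ induce linear maps $\phi:\mathbb{Z}^n\to\mathbb{Z}^t$, $e_i\mapsto e_{\phi(i)}$, and similarly $\phi'$. $\mathcal{B}$ is $\mathcal{A}$-graded by $\phi$ if $\phi(\ker_{\mathbb{Z}}\mathcal{B})\subseteq\ker_{\mathbb{Z}}\mathcal{A}$ (similarly for $\mathcal{B}'$). $\mathcal{B}\times_{\mathcal{A}}\mathcal{B}'$ is the matrix with columns $\binom{b_i}{b'_j}$ indexed by pairs $(i,j)$ with $\phi(i)=\phi'(j)$. Let $\mathbb{Z}^{P}$ be the free abelian group on the index set $P$ of these pairs. $\psi:\mathbb{Z}^P\to\mathbb{Z}^n$, $e_{i,j}\mapsto e_i$; $\psi':\mathbb{Z}^P\to\mathbb{Z}^{n'}$, $e_{i,j}\mapsto e_j$; $\xi=\phi\circ\psi=\phi'\circ\psi'$. Additive preorder on $\mathbb{Z}^n$: a reflexive, transitive relation $\succeq$ such that any two elements are comparable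 and $u\succeq v\Rightarrow u+w\succeq v+w$. Here $\succeq_\times,\succeq_{\mathcal{B}},\succeq_{\mathcal{B}'},\succeq_{\mathcal{A}}$ are additive preorders on $\mathbb{Z}^P,\mathbb{Z}^n,\mathbb{Z}^{n'},\mathbb{Z}^t$ such that: (i) for $u,v$ in a common fiber of $\mathcal{B}$ with $\phi(u)\ne\phi(v)$, $u\succeq_{\mathcal{B}}v\iff\phi(u)\succeq_{\mathcal{A}}\phi(v)$; likewise for $(\mathcal{B}',\phi',\succeq_{\mathcal{B}'})$ and $(\mathcal{B}\times_{\mathcal{A}}\mathcal{B}',\xi,\succeq_\times)$; (ii) for all $u_1,u_2\in\mathbb{Z}^P$, if $\psi(u_1)\succeq_{\mathcal{B}}\psi(u_2)$ and $\psi'(u_1)\succeq_{\mathcal{B}'}\psi'(u_2)$ then $u_1\succeq_\times u_2$. Gröbner basis: for $F,\mathcal{M}\subseteq\mathbb{Z}^n$, $F_{\mathcal{M},\succeq}$ is the directed graph on $F$ with edge $u\to v$ iff $v-u\in\pm\mathcal{M}$ and $u\succeq v$; $\sim$ is mutual reachability. $\mathcal{M}$ is a $\succeq$-Gröbner basis of a family $\mathcal{F}$ if for all $F\in\mathcal{F}$ the graph $F_{\mathcal{M},\succeq}$ is weakly connected, $F_{\mathcal{M},\succeq}/{\sim}$ has at most one sink, and each sink is a $\succeq$-minimum of $F$. Lift: for a linear map $\chi:\mathbb{Z}^n\to\mathbb{Z}^t$, an $(\mathcal{F},\chi,\succeq)$-lift of $\mathcal{G}\subseteq\mathbb{Z}^t$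 is a set $\mathcal{M}\subseteq\mathbb{Z}^n$ such that for all $F\in\mathcal{F}$ and $v,v'\in F$ with $v\succeq v'$ and $\chi(v-v')\in\mathcal{G}$ there are $m_0\in\ker_{\mathbb{Z}}\chi$ and $m\in\mathcal{M}$ with $v+m_0,\ v+m_0+m\in F$, $v\succeq v+m_0\succeq v+m_0+m$ and $\chi(v+m_0+m)=\chi(v')$. Glues: let $m\in\ker_{\mathbb{Z}}\mathcal{B}$, $m'\in\ker_{\mathbb{Z}}\mathcal{B}'$ with $\phi(m)=\phi'(m')$, and let $v=\phi'(m'^{+})-\phi(m^{+})$, where $x=x^+-x^-$ is the decomposition into positive and negative part. A glue of $m$ and $m'$ is a vector $\tilde m=p-q$ with $p,q\in\mathbb{N}^P$ for which there are $x\in\mathbb{N}^n$, $y\in\mathbb{N}^{n'}$ with $\phi(x)=v^+$, $\phi'(y)=v^-$, $\psi(p)=m^{+}+x$, $\psi'(p)=m'^{+}+y$, $\psi(q)=m^{-}+x$, $\psi'(q)=m'^{-}+y$. $\operatorname{Glues}(\mathcal{M},\mathcal{M}')$ is the set of all glues of pairs $m\in\mathcal{M}$, $m'\in\mathcal{M}'$ with $\phi(m)=\phi'(m')$. *)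

theory Defs
  imports "HOL-Library.Poly_Mapping"
begin

text \<open>
  Vectors over an index set \<open>I\<close> are elements of the free abelian group on \<open>I\<close>, i.e. integer
  functions with finite support contained in \<open>I\<close>; this treats \<open>\<int>^n\<close> (with \<open>I = {1..n}\<close>) and
  \<open>\<int>^P\<close> for a set \<open>P\<close> of pairs uniformly. \<^const>\<open>frag_of\<close> \<open>i\<close> is the unit vector \<open>e\<^sub>i\<close>.
\<close>

definition zvecs :: "'i set \<Rightarrow> ('i \<Rightarrow>\<^sub>0 int) set" where
  "zvecs I = {v. Poly_Mapping.keys v \<subseteq> I}"

definition nvecs :: "'i set \<Rightarrow> ('i \<Rightarrow>\<^sub>0 int) set" where
  "nvecs I = {v \<in> zvecs I. \<forall>i. 0 \<le> Poly_Mapping.lookup v i}"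

definition pos_part :: "('i \<Rightarrow>\<^sub>0 int) \<Rightarrow> 'i \<Rightarrow>\<^sub>0 int" where
  "pos_part v = Poly_Mapping.map (max 0) v"

definition neg_part :: "('i \<Rightarrow>\<^sub>0 int) \<Rightarrow> 'i \<Rightarrow>\<^sub>0 int" where
  "neg_part v = pos_part (- v)"

text \<open>The linear map sending \<open>e\<^sub>i\<close> to the unit vector at \<open>f i\<close>.\<close>

definition push :: "('i \<Rightarrow> 'j) \<Rightarrow> ('i \<Rightarrow>\<^sub>0 int) \<Rightarrow> 'j \<Rightarrow>\<^sub>0 int" where
  "push f = frag_extend (\<lambda>i. frag_of (f i))"

definition int_ker :: "'i set \<Rightarrow> (('i \<Rightarrow>\<^sub>0 int) \<Rightarrow> ('j \<Rightarrow>\<^sub>0 int)) \<Rightarrow> ('i \<Rightarrow>\<^sub>0 int) set" where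
  "int_ker I \<chi> = {v \<in> zvecs I. \<chi> v = 0}"

text \<open>
  An integer matrix is given by its family of columns \<open>B i\<close> (\<open>i \<in> I\<close>), each an integer vector
  indexed by the row type \<open>'r\<close>; then \<^const>\<open>frag_extend\<close> \<open>B v\<close> is the matrix-vector product
  \<open>\<Sum>i. v\<^sub>i B\<^sub>i\<close>. No row set is specified: finitely many finitely supported columns have only
  finitely many nonzero rows, and zero rows change neither kernels nor nonempty fibers.
\<close>

type_synonym ('i, 'r) int_matrix = "'i \<Rightarrow> ('r \<Rightarrow>\<^sub>0 int)"

definition fiber :: "'i set \<Rightarrow> ('i, 'r) int_matrix \<Rightarrow> ('r \<Rightarrow>\<^sub>0 int) \<Rightarrow> ('i \<Rightarrow>\<^sub>0 int) set" where
  "fiber I B b = {v \<in> nvecs I. frag_extend B v = b}"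

definition fibers :: "'i set \<Rightarrow> ('i, 'r) int_matrix \<Rightarrow> ('i \<Rightarrow>\<^sub>0 int) set set" where
  "fibers I B = range (fiber I B)"

definition graded ::
    "'t set \<Rightarrow> ('t, 'a) int_matrix \<Rightarrow> 'i set \<Rightarrow> ('i, 'r) int_matrix \<Rightarrow> ('i \<Rightarrow> 't) \<Rightarrow> bool" where
  "graded T A I B \<phi> \<longleftrightarrow> push \<phi> ` int_ker I (frag_extend B) \<subseteq> int_ker T (frag_extend A)"

definition tfp_index :: "'i set \<Rightarrow> 'j set \<Rightarrow> ('i \<Rightarrow> 't) \<Rightarrow> ('j \<Rightarrow> 't) \<Rightarrow> ('i \<times> 'j) set" where
  "tfp_index I J \<phi> \<phi>' = {(i, j). i \<in> I \<and> j \<in> J \<and> \<phi> i = \<phi>' j}"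

text \<open>
  The toric fiber product: the column at \<open>(i, j)\<close> is \<open>B i\<close> stacked on \<open>B' j\<close>, with rows indexed
  by the disjoint sum. It is only used with the index set \<^const>\<open>tfp_index\<close>.
\<close>

definition tfp :: "('i, 'r) int_matrix \<Rightarrow> ('j, 's) int_matrix \<Rightarrow> ('i \<times> 'j, 'r + 's) int_matrix" where
  "tfp B B' = (\<lambda>(i, j). push Inl (B i) + push Inr (B' j))"

text \<open>For a preorder, \<open>r u v\<close> stands for \<open>u \<succeq> v\<close>.\<close>

definition additive_preorder ::
    "'i set \<Rightarrow> (('i \<Rightarrow>\<^sub>0 int) \<Rightarrow> ('i \<Rightarrow>\<^sub>0 int) \<Rightarrow> bool) \<Rightarrow> bool" where
  "additive_preorder I r \<longleftrightarrow>
     reflp_on (zvecs I) r \<and> transp_on (zvecs I) r \<and> totalp_on (zvecs I) r \<and>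
     (\<forall>u\<in>zvecs I. \<forall>v\<in>zvecs I. \<forall>w\<in>zvecs I. r u v \<longrightarrow> r (u + w) (v + w))"

definition fiber_compatible ::
    "('i \<Rightarrow>\<^sub>0 int) set set \<Rightarrow> (('i \<Rightarrow>\<^sub>0 int) \<Rightarrow> ('t \<Rightarrow>\<^sub>0 int)) \<Rightarrow>
     (('i \<Rightarrow>\<^sub>0 int) \<Rightarrow> ('i \<Rightarrow>\<^sub>0 int) \<Rightarrow> bool) \<Rightarrow> (('t \<Rightarrow>\<^sub>0 int) \<Rightarrow> ('t \<Rightarrow>\<^sub>0 int) \<Rightarrow> bool) \<Rightarrow> bool" where
  "fiber_compatible \<F> \<chi> r s \<longleftrightarrow>
     (\<forall>F\<in>\<F>. \<forall>u\<in>F. \<forall>v\<in>F. \<chi> u \<noteq> \<chi> v \<longrightarrow> (r u v \<longleftrightarrow> s (\<chi> u) (\<chi> v)))"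

definition move_edge ::
    "('i \<Rightarrow>\<^sub>0 int) set \<Rightarrow> ('i \<Rightarrow>\<^sub>0 int) set \<Rightarrow> (('i \<Rightarrow>\<^sub>0 int) \<Rightarrow> ('i \<Rightarrow>\<^sub>0 int) \<Rightarrow> bool) \<Rightarrow>
     ('i \<Rightarrow>\<^sub>0 int) \<Rightarrow> ('i \<Rightarrow>\<^sub>0 int) \<Rightarrow> bool" where
  "move_edge F M r u v \<longleftrightarrow> u \<in> F \<and> v \<in> F \<and> v - u \<in> M \<union> uminus ` M \<and> r u v"

text \<open>The empty graph counts as weakly connected, so empty fibers impose no condition.\<close>

definition weakly_connected :: "'v set \<Rightarrow> ('v \<Rightarrow> 'v \<Rightarrow> bool) \<Rightarrow> bool" where
  "weakly_connected V E \<longleftrightarrow> (\<forall>u\<in>V. \<forall>v\<in>V. equivclp E u v)"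

definition mutual_reach :: "'v set \<Rightarrow> ('v \<Rightarrow> 'v \<Rightarrow> bool) \<Rightarrow> ('v \<times> 'v) set" where
  "mutual_reach V E = {(u, v). u \<in> V \<and> v \<in> V \<and> E\<^sup>*\<^sup>* u v \<and> E\<^sup>*\<^sup>* v u}"

text \<open>Sinks of the quotient graph; edges inside a class (loops of the quotient) are disregarded.\<close>

definition quotient_sinks :: "'v set \<Rightarrow> ('v \<Rightarrow> 'v \<Rightarrow> bool) \<Rightarrow> 'v set set" where
  "quotient_sinks V E =
     {C \<in> V // mutual_reach V E.
        \<not> (\<exists>D \<in> V // mutual_reach V E. D \<noteq> C \<and> (\<exists>u\<in>C. \<exists>v\<in>D. E u v))}"

definition groebner_basis ::
    "'i set \<Rightarrow> (('i \<Rightarrow>\<^sub>0 int) \<Rightarrow> ('i \<Rightarrow>\<^sub>0 int) \<Rightarrow> bool) \<Rightarrow> ('i \<Rightarrow>\<^sub>0 int) set set \<Rightarrow>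
     ('i \<Rightarrow>\<^sub>0 int) set \<Rightarrow> bool" where
  "groebner_basis I r \<F> M \<longleftrightarrow> M \<subseteq> zvecs I \<and>
     (\<forall>F\<in>\<F>.
        weakly_connected F (move_edge F M r) \<and>
        (\<forall>C\<in>quotient_sinks F (move_edge F M r).
           \<forall>D\<in>quotient_sinks F (move_edge F M r). C = D) \<and>
        (\<forall>C\<in>quotient_sinks F (move_edge F M r). \<forall>u\<in>C. \<forall>v\<in>F. r v u))"

text \<open>\<open>M\<close> is an \<open>(\<F>, \<chi>, r)\<close>-lift of \<open>G\<close>, where \<open>\<chi>\<close> has domain \<open>\<int>^I\<close>.\<close>

definition is_lift ::
    "'i set \<Rightarrow> ('i \<Rightarrow>\<^sub>0 int) set set \<Rightarrow> (('i \<Rightarrow>\<^sub>0 int) \<Rightarrow> ('t \<Rightarrow>\<^sub>0 int)) \<Rightarrow>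
     (('i \<Rightarrow>\<^sub>0 int) \<Rightarrow> ('i \<Rightarrow>\<^sub>0 int) \<Rightarrow> bool) \<Rightarrow> ('t \<Rightarrow>\<^sub>0 int) set \<Rightarrow> ('i \<Rightarrow>\<^sub>0 int) set \<Rightarrow> bool" where
  "is_lift I \<F> \<chi> r G M \<longleftrightarrow> M \<subseteq> zvecs I \<and>
     (\<forall>F\<in>\<F>. \<forall>v\<in>F. \<forall>v'\<in>F. r v v' \<and> \<chi> (v - v') \<in> G \<longrightarrow>
        (\<exists>m0\<in>int_ker I \<chi>. \<exists>m\<in>M.
           v + m0 \<in> F \<and> v + m0 + m \<in> F \<and>
           r v (v + m0) \<and> r (v + m0) (v + m0 + m) \<and>
           \<chi> (v + m0 + m) = \<chi> v'))"

text \<open>Glues of a pair \<open>(m, m')\<close> with \<open>push \<phi> m = push \<phi>' m'\<close>.\<close>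

definition is_glue ::
    "'i set \<Rightarrow> 'j set \<Rightarrow> ('i \<Rightarrow> 't) \<Rightarrow> ('j \<Rightarrow> 't) \<Rightarrow> ('i \<Rightarrow>\<^sub>0 int) \<Rightarrow> ('j \<Rightarrow>\<^sub>0 int) \<Rightarrow>
     ('i \<times> 'j \<Rightarrow>\<^sub>0 int) \<Rightarrow> bool" where
  "is_glue I J \<phi> \<phi>' m m' g \<longleftrightarrow>
     (let v = push \<phi>' (pos_part m') - push \<phi> (pos_part m) in
      \<exists>p\<in>nvecs (tfp_index I J \<phi> \<phi>'). \<exists>q\<in>nvecs (tfp_index I J \<phi> \<phi>').
      \<exists>x\<in>nvecs I. \<exists>y\<in>nvecs J.
        g = p - q \<and> push \<phi> x = pos_part v \<and> push \<phi>' y = neg_part v \<and>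
        push fst p = pos_part m + x \<and> push snd p = pos_part m' + y \<and>
        push fst q = neg_part m + x \<and> push snd q = neg_part m' + y)"

definition Glues ::
    "'i set \<Rightarrow> 'j set \<Rightarrow> ('i \<Rightarrow> 't) \<Rightarrow> ('j \<Rightarrow> 't) \<Rightarrow> ('i \<Rightarrow>\<^sub>0 int) set \<Rightarrow> ('j \<Rightarrow>\<^sub>0 int) set \<Rightarrow>
     ('i \<times> 'j \<Rightarrow>\<^sub>0 int) set" where
  "Glues I J \<phi> \<phi>' M M' =
     {g. \<exists>m\<in>M. \<exists>m'\<in>M'. push \<phi> m = push \<phi>' m' \<and> is_glue I J \<phi> \<phi>' m m' g}"

end

theory Submission
  imports Defs
begin

text \<open>
  The toric fiber product behaves like a fibered product of monoids: two vectors
  \<open>a \<in> \<nat>^I\<close> and \<open>b \<in> \<nat>^J\<close> with \<open>\<phi> a = \<phi>' b\<close> are the two projections of some \<open>w \<in> \<nat>^P\<close>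
  (lemma \<open>tfp_vector_exists\<close>), because a multiset over \<open>I\<close> and one over \<open>J\<close> with the same
  image can be matched element by element. Moreover the product matrix only sees the two
  projections of a vector (\<open>frag_extend_tfp\<close>), so membership in its fibers can be tested
  after projecting.

  Let \<open>v \<succeq> v'\<close> lie in a fiber of the product with \<open>\<xi> (v - v') \<in> G\<close>. Provided the projections of
  \<open>v\<close> and \<open>v'\<close> are ordered the same way, the two lifts yield moves \<open>m \<in> M\<close>, \<open>m' \<in> M'\<close> that
  start at vectors \<open>a\<close>, \<open>b\<close> below the projections of \<open>v\<close>, with \<open>\<phi> a = \<phi>' b = \<xi> v\<close> and
  \<open>\<phi> m = \<phi>' m' = \<xi> (v' - v)\<close>. Applying \<open>m\<close> consumes \<open>neg_part m\<close> and produces \<open>pos_part m\<close>,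
  likewise \<open>m'\<close>. What \<open>m\<close> consumes and what \<open>m'\<close> consumes may have different images in \<open>\<int>^t\<close>, and
  then they cannot be paired off. The discrepancy is the same for the produced parts, since
  \<open>\<phi> m = \<phi>' m'\<close>; call it \<open>d\<close>. There is enough left in \<open>a\<close> and \<open>b\<close> to compensate it: one can choose
  \<open>x\<close> and \<open>y\<close> inside the unused parts whose images are the positive and the negative part of \<open>d\<close>
  (\<open>subvector_with_push\<close>). Let \<open>x\<close> and \<open>y\<close> be consumed and reproduced as well. Now everything
  matches: pairing off what is consumed gives \<open>q\<close>, what is produced \<open>p\<close>, and the untouched rest
  \<open>w\<close>. So \<open>p - q\<close> is a glue that moves \<open>w + q\<close> to \<open>w + p\<close>, and these project to the start and the
  end of the two moves (\<open>glue_exists\<close>). Compatibility of the preorders carries the two descents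
  over to \<open>v \<succeq> w + q \<succeq> w + p\<close>.

  If \<open>\<xi> v \<noteq> \<xi> v'\<close>, the projections are ordered as required because on fibers all preorders are
  controlled by the one on \<open>\<int>^t\<close>. If \<open>\<xi> v = \<xi> v'\<close>, they need not be, but a lift only has to hit the
  image of \<open>v'\<close>, which is that of \<open>v\<close>, so \<open>v'\<close> may be replaced by \<open>v\<close>.
\<close>

section \<open>Nonnegative vectors and induced linear maps\<close>

lemma nvecs_iff:
  "v \<in> nvecs I \<longleftrightarrow> (\<forall>i. 0 \<le> Poly_Mapping.lookup v i \<and> (i \<notin> I \<longrightarrow> Poly_Mapping.lookup v i = 0))"
  by (auto simp: nvecs_def zvecs_def in_keys_iff)

lemma nvecs_add: "u \<in> nvecs I \<Longrightarrow> v \<in> nvecs I \<Longrightarrow> u + v \<in> nvecs I"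
  by (simp add: nvecs_iff lookup_add)

lemma nvecs_frag_of: "i \<in> I \<Longrightarrow> frag_of i \<in> nvecs I"
  by (auto simp: nvecs_iff)

lemma nvecs_imp_zvecs: "v \<in> nvecs I \<Longrightarrow> v \<in> zvecs I"
  by (simp add: nvecs_def)

lemma zvecs_diff: "u \<in> zvecs I \<Longrightarrow> v \<in> zvecs I \<Longrightarrow> u - v \<in> zvecs I"
  unfolding zvecs_def using keys_diff[of u v] by blast

lemma frag_hom_eqI:
  assumes "\<And>u v. h (u - v) = h u - (h v :: 'b::ab_group_add)"
    and "\<And>u v. k (u - v) = k u - k v"
    and "\<And>i. h (frag_of i) = k (frag_of i)"
  shows "h v = k v"
proof -
  have zero: "h 0 = 0" "k 0 = 0"
    using assms(1)[of 0 0] assms(2)[of 0 0] by simp_all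
  have "Poly_Mapping.keys v \<subseteq> UNIV" by simp
  then show ?thesis
    by (induction v rule: frag_induction) (simp_all add: assms zero)
qed

lemma push_0 [simp]: "push f 0 = 0"
  by (simp add: push_def)

lemma push_add: "push f (u + v) = push f u + push f v"
  by (simp add: push_def frag_extend_add)

lemma push_diff: "push f (u - v) = push f u - push f v"
  by (simp add: push_def frag_extend_diff)

lemma push_frag_of [simp]: "push f (frag_of i) = frag_of (f i)"
  by (simp add: push_def)

lemma lookup_push:
  "Poly_Mapping.lookup (push f v) k =
    (\<Sum>i\<in>Poly_Mapping.keys v. Poly_Mapping.lookup v i * (if f i = k then 1 else 0))"
  unfolding push_def frag_extend_def lookup_sum by (auto intro!: sum.cong)

lemma push_nvecs: "v \<in> nvecs I \<Longrightarrow> f ` I \<subseteq> K \<Longrightarrow> push f v \<in> nvecs K"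
  unfolding nvecs_iff lookup_push
  by (fastforce intro!: sum_nonneg sum.neutral simp: in_keys_iff)

lemma nvecs_remove_unit:
  assumes v: "v \<in> nvecs I" and k: "0 < Poly_Mapping.lookup (push f v) k"
  obtains i where "i \<in> I" "f i = k" "v - frag_of i \<in> nvecs I"
proof -
  obtain i where i: "i \<in> Poly_Mapping.keys v" "f i = k"
  proof (rule ccontr)
    assume "\<not> thesis"
    with that have "Poly_Mapping.lookup (push f v) k = 0"
      unfolding lookup_push by (intro sum.neutral) auto
    with k show False by simp
  qed
  then have "0 < Poly_Mapping.lookup v i"
    using v by (metis in_keys_iff less_le nvecs_iff)
  then have "v - frag_of i \<in> nvecs I" "i \<in> I"
    using v by (auto simp: nvecs_iff lookup_minus)
  with that i(2) show thesis by blast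
qed

text \<open>
  The sum of the coefficients serves as the size of a vector; it is the single coefficient of
  the image under the map that identifies all indices.
\<close>

lemma nvecs_induct [consumes 1, case_names zero unit]:
  assumes "v \<in> nvecs I" and "P 0"
    and step: "\<And>u i. u \<in> nvecs I \<Longrightarrow> i \<in> I \<Longrightarrow> P u \<Longrightarrow> P (u + frag_of i)"
  shows "P v"
  using assms(1)
proof (induction "nat (Poly_Mapping.lookup (push (\<lambda>_. ()) v) ())" arbitrary: v rule: less_induct)
  case less
  show ?case
  proof (cases "v = 0")
    case True
    with assms(2) show ?thesis by simp
  next
    case False
    then obtain j where "Poly_Mapping.lookup v j \<noteq> 0"
      by (metis lookup_zero poly_mapping_eqI)
    then have "0 < Poly_Mapping.lookup v j"
      using less.prems by (metis less_le nvecs_iff)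
    then have "0 < Poly_Mapping.lookup (push (\<lambda>i. i) v) j"
      by (simp add: push_def frag_expansion[symmetric])
    with less.prems obtain i where i: "i \<in> I" "v - frag_of i \<in> nvecs I"
      by (rule nvecs_remove_unit)
    have "push (\<lambda>_. ()) (v - frag_of i) \<in> nvecs UNIV"
      by (rule push_nvecs[OF i(2) subset_UNIV])
    then have "0 \<le> Poly_Mapping.lookup (push (\<lambda>_. ()) (v - frag_of i)) ()"
      by (simp add: nvecs_iff)
    then have "P (v - frag_of i)"
      by (intro less.hyps i(2)) (simp add: push_diff lookup_minus)
    with step[OF i(2,1)] show ?thesis by simp
  qed
qed

lemma push_add_frag_of_pos:
  assumes "u \<in> nvecs I"
  shows "0 < Poly_Mapping.lookup (push f u + frag_of k) k"
  using push_nvecs[OF assms subset_refl, of f] by (auto simp: nvecs_iff lookup_add intro: add_nonneg_pos)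

lemma nvecs_push_eq_0:
  assumes "v \<in> nvecs I" "push f v = 0"
  shows "v = 0"
  using assms
proof (induction rule: nvecs_induct)
  case (unit u i)
  with push_add_frag_of_pos[of u I f "f i"] show ?case
    by (simp add: push_add)
qed simp

section \<open>Matching and splitting nonnegative vectors\<close>

text \<open>
  Pair off the units of \<open>a\<close> one at a time with units of \<open>b\<close> of the same image. When \<open>a\<close> is used up,
  so is \<open>b\<close>, since a nonzero nonnegative vector has nonzero image.
\<close>

lemma tfp_vector_exists:
  assumes "a \<in> nvecs I" "b \<in> nvecs J" "push \<phi> a = push \<phi>' b"
  obtains w where "w \<in> nvecs (tfp_index I J \<phi> \<phi>')" "push fst w = a" "push snd w = b"
proof -
  have "\<exists>w\<in>nvecs (tfp_index I J \<phi> \<phi>'). push fst w = a \<and> push snd w = b"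
    using assms
  proof (induction a arbitrary: b rule: nvecs_induct)
    case zero
    then have "b = 0" using nvecs_push_eq_0 by fastforce
    then show ?case by (intro bexI[of _ 0]) (auto simp: nvecs_iff)
  next
    case (unit u i)
    then have "0 < Poly_Mapping.lookup (push \<phi>' b) (\<phi> i)"
      using push_add_frag_of_pos[of u I \<phi> "\<phi> i"] by (metis push_add push_frag_of)
    with unit.prems(1) obtain j where j: "j \<in> J" "\<phi>' j = \<phi> i" "b - frag_of j \<in> nvecs J"
      by (rule nvecs_remove_unit)
    have "push \<phi> u = push \<phi>' (b - frag_of j)"
      using unit.prems(2) j(2) by (simp add: push_add push_diff flip: eq_diff_eq)
    with unit.IH j(3) obtain w where w: "w \<in> nvecs (tfp_index I J \<phi> \<phi>')"
      "push fst w = u" "push snd w = b - frag_of j"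
      by blast
    have "(i, j) \<in> tfp_index I J \<phi> \<phi>'"
      using unit.hyps j by (simp add: tfp_index_def)
    with w show ?case
      by (intro bexI[of _ "w + frag_of (i, j)"])
        (auto simp: push_add intro: nvecs_add nvecs_frag_of)
  qed
  with that show thesis by blast
qed

text \<open>
  Collect \<open>x\<close> unit by unit: as long as \<open>c\<close> is not exhausted, \<open>a - x\<close> still has a unit of the
  needed image.
\<close>

lemma subvector_with_push:
  assumes a: "a \<in> nvecs I" and c: "c \<in> nvecs UNIV" "push f a - c \<in> nvecs UNIV"
  obtains x where "x \<in> nvecs I" "a - x \<in> nvecs I" "push f x = c"
proof -
  have "\<exists>x\<in>nvecs I. a - x \<in> nvecs I \<and> push f x = c"
    using c
  proof (induction c rule: nvecs_induct)
    case zero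
    with a show ?case by (intro bexI[of _ 0]) (auto simp: nvecs_iff)
  next
    case (unit u k)
    let ?r = "push f a - (u + frag_of k)"
    have split: "push f a - u = ?r + frag_of k" by simp
    have "push f a - u \<in> nvecs UNIV"
      unfolding split using unit.prems by (intro nvecs_add nvecs_frag_of) auto
    with unit.IH obtain x where x: "x \<in> nvecs I" "a - x \<in> nvecs I" "push f x = u"
      by blast
    have "0 < Poly_Mapping.lookup (push f (a - x)) k"
      using unit.prems unfolding push_diff x(3) split nvecs_iff lookup_add
      by (simp add: add_nonneg_pos)
    with x(2) obtain i where i: "i \<in> I" "f i = k" "a - x - frag_of i \<in> nvecs I"
      by (rule nvecs_remove_unit)
    with x show ?case
      by (intro bexI[of _ "x + frag_of i"])
        (auto simp: push_add diff_diff_eq intro: nvecs_add nvecs_frag_of)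
  qed
  with that show thesis by blast
qed

section \<open>Glues\<close>

lemma lookup_pos_part: "Poly_Mapping.lookup (pos_part v) i = max 0 (Poly_Mapping.lookup v i)"
  by (auto simp: pos_part_def Poly_Mapping.map.rep_eq when_def)

lemma lookup_neg_part: "Poly_Mapping.lookup (neg_part v) i = max 0 (- Poly_Mapping.lookup v i)"
  by (simp add: neg_part_def lookup_pos_part)

lemma pos_part_eq: "pos_part v = v + neg_part v"
  by (rule poly_mapping_eqI) (simp add: lookup_add lookup_pos_part lookup_neg_part)

lemma pos_part_nvecs: "v \<in> zvecs I \<Longrightarrow> pos_part v \<in> nvecs I"
  unfolding nvecs_iff lookup_pos_part zvecs_def
  by (metis in_keys_iff max.cobounded1 max.idem mem_Collect_eq subsetD)

lemma neg_part_nvecs: "v \<in> zvecs I \<Longrightarrow> neg_part v \<in> nvecs I"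
  unfolding neg_part_def by (rule pos_part_nvecs) (simp add: zvecs_def)

lemma nvecs_diff_neg_part:
  assumes "a \<in> nvecs I" "a + m \<in> nvecs I"
  shows "a - neg_part m \<in> nvecs I"
  unfolding nvecs_iff lookup_minus lookup_neg_part
proof
  fix i
  have "0 \<le> Poly_Mapping.lookup a i" "0 \<le> Poly_Mapping.lookup a i + Poly_Mapping.lookup m i"
    "i \<notin> I \<Longrightarrow> Poly_Mapping.lookup a i = 0"
    "i \<notin> I \<Longrightarrow> Poly_Mapping.lookup a i + Poly_Mapping.lookup m i = 0"
    using assms by (simp_all add: nvecs_iff lookup_add)
  then show "0 \<le> Poly_Mapping.lookup a i - max 0 (- Poly_Mapping.lookup m i) \<and>
      (i \<notin> I \<longrightarrow> Poly_Mapping.lookup a i - max 0 (- Poly_Mapping.lookup m i) = 0)"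
    by auto
qed

text \<open>
  The part of \<open>a\<close> that \<open>m\<close> leaves untouched and the part of \<open>b\<close> that \<open>m'\<close> leaves untouched
  have images \<open>r\<close> and \<open>r'\<close> with \<open>r - r' = v\<close>. As both are nonnegative, \<open>r\<close> dominates
  \<open>pos_part v\<close> and \<open>r'\<close> dominates \<open>neg_part v\<close>, so the correction terms \<open>x\<close> and \<open>y\<close> of a glue
  fit inside the untouched parts, and what remains of these has equal images.
\<close>

lemma glue_exists:
  assumes a: "a \<in> nvecs I" "a + m \<in> nvecs I"
    and b: "b \<in> nvecs J" "b + m' \<in> nvecs J"
    and ab: "push \<phi> a = push \<phi>' b" and mm': "push \<phi> m = push \<phi>' m'"
  obtains s g where "is_glue I J \<phi> \<phi>' m m' g"
    "s \<in> nvecs (tfp_index I J \<phi> \<phi>')" "s + g \<in> nvecs (tfp_index I J \<phi> \<phi>')"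
    "push fst s = a" "push snd s = b" "push fst (s + g) = a + m" "push snd (s + g) = b + m'"
proof -
  have m: "m \<in> zvecs I" and m': "m' \<in> zvecs J"
    using zvecs_diff[of "a + m" I a] zvecs_diff[of "b + m'" J b] a b
    by (simp_all add: nvecs_imp_zvecs)
  define v where "v = push \<phi>' (pos_part m') - push \<phi> (pos_part m)"
  have v_eq: "v = push \<phi>' (neg_part m') - push \<phi> (neg_part m)"
    by (simp add: v_def pos_part_eq[of m] pos_part_eq[of m'] push_add mm')
  define r where "r = push \<phi> (a - neg_part m)"
  define r' where "r' = push \<phi>' (b - neg_part m')"
  have am: "a - neg_part m \<in> nvecs I" and bm: "b - neg_part m' \<in> nvecs J"
    using a b nvecs_diff_neg_part by blast+
  then have r: "r \<in> nvecs UNIV" and r': "r' \<in> nvecs UNIV"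
    unfolding r_def r'_def by (auto intro: push_nvecs[OF _ subset_UNIV])
  have v_r: "v = r - r'"
    by (simp add: v_eq r_def r'_def push_diff ab)
  have "pos_part v \<in> nvecs UNIV" "r - pos_part v \<in> nvecs UNIV"
    using r r' by (auto simp: v_r nvecs_iff lookup_pos_part lookup_minus)
  then obtain x where x: "x \<in> nvecs I" "a - neg_part m - x \<in> nvecs I" "push \<phi> x = pos_part v"
    unfolding r_def by (rule subvector_with_push[OF am])
  have "neg_part v \<in> nvecs UNIV" "r' - neg_part v \<in> nvecs UNIV"
    using r r' by (auto simp: v_r nvecs_iff lookup_neg_part lookup_minus)
  then obtain y where y: "y \<in> nvecs J" "b - neg_part m' - y \<in> nvecs J" "push \<phi>' y = neg_part v"
    unfolding r'_def by (rule subvector_with_push[OF bm])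
  have "push \<phi> (a - neg_part m - x) = push \<phi>' (b - neg_part m' - y)"
    using pos_part_eq[of v] unfolding push_diff[of _ _ x] push_diff[of _ _ y]
    by (simp add: x(3) y(3) v_r flip: r_def r'_def)
  then obtain w where w: "w \<in> nvecs (tfp_index I J \<phi> \<phi>')"
    "push fst w = a - neg_part m - x" "push snd w = b - neg_part m' - y"
    by (rule tfp_vector_exists[OF x(2) y(2)])
  have "push \<phi> (neg_part m + x) = push \<phi>' (neg_part m' + y)"
    using pos_part_eq[of v] by (simp add: push_add x(3) y(3) v_eq)
  then obtain q where q: "q \<in> nvecs (tfp_index I J \<phi> \<phi>')"
    "push fst q = neg_part m + x" "push snd q = neg_part m' + y"
    by (rule tfp_vector_exists[OF nvecs_add[OF neg_part_nvecs[OF m] x(1)]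
          nvecs_add[OF neg_part_nvecs[OF m'] y(1)]])
  have "push \<phi> (pos_part m + x) = push \<phi>' (pos_part m' + y)"
    using pos_part_eq[of v] by (simp add: push_add x(3) y(3) v_def)
  then obtain p where p: "p \<in> nvecs (tfp_index I J \<phi> \<phi>')"
    "push fst p = pos_part m + x" "push snd p = pos_part m' + y"
    by (rule tfp_vector_exists[OF nvecs_add[OF pos_part_nvecs[OF m] x(1)]
          nvecs_add[OF pos_part_nvecs[OF m'] y(1)]])
  show thesis
  proof (rule that)
    show "is_glue I J \<phi> \<phi>' m m' (p - q)"
      unfolding is_glue_def Let_def v_def[symmetric] using p q x(1,3) y(1,3) by blast
    show "w + q \<in> nvecs (tfp_index I J \<phi> \<phi>')" "w + q + (p - q) \<in> nvecs (tfp_index I J \<phi> \<phi>')"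
      using nvecs_add[OF w(1) q(1)] nvecs_add[OF w(1) p(1)] by simp_all
  qed (simp_all add: push_add push_diff w q p pos_part_eq[of m] pos_part_eq[of m'])
qed

lemma Glues_subset_zvecs: "Glues I J \<phi> \<phi>' M M' \<subseteq> zvecs (tfp_index I J \<phi> \<phi>')"
  unfolding Glues_def is_glue_def Let_def by (blast intro: zvecs_diff nvecs_imp_zvecs)

section \<open>Fibers of the toric fiber product\<close>

lemma frag_extend_tfp:
  "frag_extend (tfp B B') u =
     push Inl (frag_extend B (push fst u)) + push Inr (frag_extend B' (push snd u))"
proof (rule frag_hom_eqI[where h = "frag_extend (tfp B B')"])
  show "frag_extend (tfp B B') (frag_of i) =
      push Inl (frag_extend B (push fst (frag_of i))) +
      push Inr (frag_extend B' (push snd (frag_of i)))" for i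
    by (simp add: tfp_def split: prod.split)
qed (simp_all add: push_diff frag_extend_diff)

text \<open>
  Each block of a stacked vector is recovered by the linear map that kills the unit vectors of the
  other block.
\<close>

lemma stacked_eq_iff:
  "push Inl a + push Inr b = push Inl a' + push Inr b' \<longleftrightarrow> a = a' \<and> b = b'"
proof -
  let ?l = "frag_extend (case_sum frag_of (\<lambda>_. 0))"
  let ?r = "frag_extend (case_sum (\<lambda>_. 0) frag_of)"
  have "?l (push Inl c + push Inr d) = c" "?r (push Inl c + push Inr d) = d" for c d
    unfolding push_def frag_extend_add
    by (simp_all add: frag_extend_compose[unfolded comp_def] frag_extend_eq_0 flip: frag_expansion)
  then show ?thesis by metis
qed

lemma tfp_fiber_iff:
  assumes "u \<in> fiber (tfp_index I J \<phi> \<phi>') (tfp B B') c" "w \<in> nvecs (tfp_index I J \<phi> \<phi>')"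
  shows "w \<in> fiber (tfp_index I J \<phi> \<phi>') (tfp B B') c \<longleftrightarrow>
    frag_extend B (push fst w) = frag_extend B (push fst u) \<and>
    frag_extend B' (push snd w) = frag_extend B' (push snd u)"
  using assms by (auto simp: fiber_def frag_extend_tfp stacked_eq_iff)

lemma tfp_index_projections:
  assumes "u \<in> nvecs (tfp_index I J \<phi> \<phi>')"
  shows "push fst u \<in> nvecs I" "push snd u \<in> nvecs J"
  using assms by (auto intro!: push_nvecs simp: tfp_index_def)

lemma xi_eq:
  assumes "u \<in> nvecs (tfp_index I J \<phi> \<phi>')"
  shows "push \<phi> (push fst u) = push \<phi>' (push snd u)"
  using assms by (induction rule: nvecs_induct) (auto simp: push_add tfp_index_def)

section \<open>Lifting to the toric fiber product\<close>

lemma is_liftE: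
  assumes lift: "is_lift I (fibers I B) (push \<phi>) r G M"
    and v: "v \<in> nvecs I" "v' \<in> nvecs I" "frag_extend B v' = frag_extend B v"
    and "r v v'" "push \<phi> (v - v') \<in> G"
  obtains a m where "m \<in> M" "a \<in> nvecs I" "a + m \<in> nvecs I"
    "frag_extend B a = frag_extend B v" "frag_extend B (a + m) = frag_extend B v"
    "r v a" "r a (a + m)" "push \<phi> a = push \<phi> v" "push \<phi> (a + m) = push \<phi> v'"
proof -
  let ?F = "fiber I B (frag_extend B v)"
  have "?F \<in> fibers I B" "v \<in> ?F" "v' \<in> ?F"
    using v by (auto simp: fibers_def fiber_def)
  with lift assms(5,6) obtain m0 m where "m0 \<in> int_ker I (push \<phi>)" "m \<in> M"
    "v + m0 \<in> ?F" "v + m0 + m \<in> ?F" "r v (v + m0)" "r (v + m0) (v + m0 + m)"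
    "push \<phi> (v + m0 + m) = push \<phi> v'"
    unfolding is_lift_def by blast
  then show thesis
    by (intro that[of m "v + m0"]) (auto simp: fiber_def int_ker_def push_add)
qed

text \<open>
  When both projections of the pair descend, both lifts apply, and the moves that they supply
  start over the same point and have the same image; gluing these moves lifts the pair.
\<close>

lemma Glues_lift_step:
  assumes compat: "\<And>u1 u2. u1 \<in> zvecs (tfp_index I J \<phi> \<phi>') \<Longrightarrow> u2 \<in> zvecs (tfp_index I J \<phi> \<phi>') \<Longrightarrow>
      r (push fst u1) (push fst u2) \<Longrightarrow> r' (push snd u1) (push snd u2) \<Longrightarrow> rP u1 u2"
    and lift: "is_lift I (fibers I B) (push \<phi>) r G M"
    and lift': "is_lift J (fibers J B') (push \<phi>') r' G M'"
    and v: "v \<in> fiber (tfp_index I J \<phi> \<phi>') (tfp B B') c"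
    and v': "v' \<in> fiber (tfp_index I J \<phi> \<phi>') (tfp B B') c"
    and ge: "r (push fst v) (push fst v')" "r' (push snd v) (push snd v')"
    and G: "push \<phi> (push fst (v - v')) \<in> G"
  obtains m0 g where "m0 \<in> int_ker (tfp_index I J \<phi> \<phi>') (push \<phi> \<circ> push fst)"
    "g \<in> Glues I J \<phi> \<phi>' M M'"
    "v + m0 \<in> fiber (tfp_index I J \<phi> \<phi>') (tfp B B') c"
    "v + m0 + g \<in> fiber (tfp_index I J \<phi> \<phi>') (tfp B B') c"
    "rP v (v + m0)" "rP (v + m0) (v + m0 + g)"
    "push \<phi> (push fst (v + m0 + g)) = push \<phi> (push fst v')"
proof -
  let ?P = "tfp_index I J \<phi> \<phi>'"
  have vP: "v \<in> nvecs ?P" and v'P: "v' \<in> nvecs ?P"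
    using v v' by (simp_all add: fiber_def)
  have B_eq: "frag_extend B (push fst v') = frag_extend B (push fst v)"
    "frag_extend B' (push snd v') = frag_extend B' (push snd v)"
    using v' tfp_fiber_iff[OF v v'P] by auto
  have G1: "push \<phi> (push fst v - push fst v') \<in> G"
    using G by (simp add: push_diff)
  have G2: "push \<phi>' (push snd v - push snd v') \<in> G"
    using G1 xi_eq[OF vP] xi_eq[OF v'P] by (simp add: push_diff)
  obtain a m where am: "m \<in> M" "a \<in> nvecs I" "a + m \<in> nvecs I"
    "frag_extend B a = frag_extend B (push fst v)"
    "frag_extend B (a + m) = frag_extend B (push fst v)"
    "r (push fst v) a" "r a (a + m)"
    "push \<phi> a = push \<phi> (push fst v)" "push \<phi> (a + m) = push \<phi> (push fst v')"
    by (rule is_liftE[OF lift tfp_index_projections(1)[OF vP] tfp_index_projections(1)[OF v'P]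
          B_eq(1) ge(1) G1])
  obtain b m' where bm: "m' \<in> M'" "b \<in> nvecs J" "b + m' \<in> nvecs J"
    "frag_extend B' b = frag_extend B' (push snd v)"
    "frag_extend B' (b + m') = frag_extend B' (push snd v)"
    "r' (push snd v) b" "r' b (b + m')"
    "push \<phi>' b = push \<phi>' (push snd v)" "push \<phi>' (b + m') = push \<phi>' (push snd v')"
    by (rule is_liftE[OF lift' tfp_index_projections(2)[OF vP] tfp_index_projections(2)[OF v'P]
          B_eq(2) ge(2) G2])
  have ab: "push \<phi> a = push \<phi>' b"
    by (simp add: am(8) bm(8) xi_eq[OF vP])
  have mm': "push \<phi> m = push \<phi>' m'"
    using am(9) bm(9) ab xi_eq[OF v'P] by (metis add_left_imp_eq push_add)
  obtain s g where sg: "is_glue I J \<phi> \<phi>' m m' g" "s \<in> nvecs ?P" "s + g \<in> nvecs ?P"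
    "push fst s = a" "push snd s = b" "push fst (s + g) = a + m" "push snd (s + g) = b + m'"
    by (rule glue_exists[OF am(2,3) bm(2,3) ab mm'])
  show thesis
  proof (rule that[of "s - v" g], simp_all)
    show "s - v \<in> int_ker ?P (push \<phi> \<circ> push fst)"
      using vP sg am(8) by (simp add: int_ker_def zvecs_diff nvecs_imp_zvecs push_diff)
    show "g \<in> Glues I J \<phi> \<phi>' M M'"
      using am(1) bm(1) mm' sg(1) by (auto simp: Glues_def)
    show "s \<in> fiber ?P (tfp B B') c" "s + g \<in> fiber ?P (tfp B B') c"
      using tfp_fiber_iff[OF v sg(2)] tfp_fiber_iff[OF v sg(3)] sg am bm by simp_all
    show "rP v s" "rP s (s + g)"
      using sg am bm vP by (auto intro!: compat nvecs_imp_zvecs)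
    show "push \<phi> (push fst (s + g)) = push \<phi> (push fst v')"
      by (simp add: sg(6) am(9))
  qed
qed

lemma additive_preorder_refl: "additive_preorder I r \<Longrightarrow> v \<in> nvecs I \<Longrightarrow> r v v"
  unfolding additive_preorder_def using nvecs_imp_zvecs reflp_onD by metis

lemma fiber_compatibleD:
  assumes "fiber_compatible (fibers I B) \<chi> r s" "u \<in> nvecs I" "v \<in> nvecs I"
    "frag_extend B v = frag_extend B u" "\<chi> u \<noteq> \<chi> v"
  shows "r u v \<longleftrightarrow> s (\<chi> u) (\<chi> v)"
proof -
  have "fiber I B (frag_extend B u) \<in> fibers I B" "u \<in> fiber I B (frag_extend B u)"
    "v \<in> fiber I B (frag_extend B u)"
    using assms by (auto simp: fibers_def fiber_def)
  with assms(1,5) show ?thesis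
    unfolding fiber_compatible_def by blast
qed

theorem lemma35:
  fixes n n' t :: nat
    and A :: "(nat, 'a) int_matrix"
    and B :: "(nat, 'r) int_matrix"
    and B' :: "(nat, 's) int_matrix"
    and \<phi> \<phi>' :: "nat \<Rightarrow> nat"
    and geqP :: "(nat \<times> nat \<Rightarrow>\<^sub>0 int) \<Rightarrow> (nat \<times> nat \<Rightarrow>\<^sub>0 int) \<Rightarrow> bool"
    and geqB geqB' geqA :: "(nat \<Rightarrow>\<^sub>0 int) \<Rightarrow> (nat \<Rightarrow>\<^sub>0 int) \<Rightarrow> bool"
    and G M M' :: "(nat \<Rightarrow>\<^sub>0 int) set"
  assumes surj: "\<phi> ` {1..n} = {1..t}"
    and surj': "\<phi>' ` {1..n'} = {1..t}"
    and graded: "graded {1..t} A {1..n} B \<phi>"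
    and graded': "graded {1..t} A {1..n'} B' \<phi>'"
    and preP: "additive_preorder (tfp_index {1..n} {1..n'} \<phi> \<phi>') geqP"
    and preB: "additive_preorder {1..n} geqB"
    and preB': "additive_preorder {1..n'} geqB'"
    and preA: "additive_preorder {1..t} geqA"
    and compB: "fiber_compatible (fibers {1..n} B) (push \<phi>) geqB geqA"
    and compB': "fiber_compatible (fibers {1..n'} B') (push \<phi>') geqB' geqA"
    and compP: "fiber_compatible (fibers (tfp_index {1..n} {1..n'} \<phi> \<phi>') (tfp B B'))
                  (push \<phi> \<circ> push fst) geqP geqA"
    and compat: "\<forall>u1\<in>zvecs (tfp_index {1..n} {1..n'} \<phi> \<phi>').
                 \<forall>u2\<in>zvecs (tfp_index {1..n} {1..n'} \<phi> \<phi>').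
                   geqB (push fst u1) (push fst u2) \<and> geqB' (push snd u1) (push snd u2)
                   \<longrightarrow> geqP u1 u2"
    and gb: "groebner_basis {1..t} geqA
               ((\<lambda>F. (push \<phi> \<circ> push fst) ` F) `
                 fibers (tfp_index {1..n} {1..n'} \<phi> \<phi>') (tfp B B')) G"
    and kerM: "M \<subseteq> int_ker {1..n} (frag_extend B)"
    and kerM': "M' \<subseteq> int_ker {1..n'} (frag_extend B')"
    and liftM: "is_lift {1..n} (fibers {1..n} B) (push \<phi>) geqB G M"
    and liftM': "is_lift {1..n'} (fibers {1..n'} B') (push \<phi>') geqB' G M'"
  shows "is_lift (tfp_index {1..n} {1..n'} \<phi> \<phi>')
           (fibers (tfp_index {1..n} {1..n'} \<phi> \<phi>') (tfp B B'))
           (push \<phi> \<circ> push fst) geqP G (Glues {1..n} {1..n'} \<phi> \<phi>' M M')"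
proof -
  let ?P = "tfp_index {1..n} {1..n'} \<phi> \<phi>'"
  have step: "\<exists>m0\<in>int_ker ?P (push \<phi> \<circ> push fst). \<exists>g\<in>Glues {1..n} {1..n'} \<phi> \<phi>' M M'.
      v + m0 \<in> F \<and> v + m0 + g \<in> F \<and> geqP v (v + m0) \<and> geqP (v + m0) (v + m0 + g) \<and>
      (push \<phi> \<circ> push fst) (v + m0 + g) = (push \<phi> \<circ> push fst) v'"
    if F: "F \<in> fibers ?P (tfp B B')" and vF: "v \<in> F" "v' \<in> F"
      and ge: "geqP v v'" and G: "(push \<phi> \<circ> push fst) (v - v') \<in> G" for F v v'
  proof -
    obtain c where c: "F = fiber ?P (tfp B B') c"
      using F by (auto simp: fibers_def)
    then have v: "v \<in> fiber ?P (tfp B B') c" and v': "v' \<in> fiber ?P (tfp B B') c"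
      using vF by auto
    then have P: "v \<in> nvecs ?P" "v' \<in> nvecs ?P" by (simp_all add: fiber_def)
    \<comment> \<open>What has to be found depends on \<open>v'\<close> only through its image \<open>\<xi> v'\<close>, so another target
      \<open>v''\<close> with this image will do; its projections must be below those of \<open>v\<close>.\<close>
    obtain v'' where v'': "v'' \<in> fiber ?P (tfp B B') c"
      "geqB (push fst v) (push fst v'')" "geqB' (push snd v) (push snd v'')"
      "push \<phi> (push fst v'') = push \<phi> (push fst v')"
    proof (cases "push \<phi> (push fst v) = push \<phi> (push fst v')")
      case True
      with that v preB preB' show thesis
        using additive_preorder_refl tfp_index_projections[OF P(1)] by blast
    next
      case False
      have eq: "frag_extend B (push fst v') = frag_extend B (push fst v)"
        "frag_extend B' (push snd v') = frag_extend B' (push snd v)"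
        using tfp_fiber_iff[OF v P(2)] v' by auto
      have geA: "geqA (push \<phi> (push fst v)) (push \<phi> (push fst v'))"
        using compP F vF ge False by (auto simp: fiber_compatible_def)
      have "geqB (push fst v) (push fst v')"
        using fiber_compatibleD[OF compB] tfp_index_projections(1) P eq(1) False geA by blast
      moreover have "geqB' (push snd v) (push snd v')"
        using fiber_compatibleD[OF compB'] tfp_index_projections(2) P eq(2) False geA
        by (metis xi_eq)
      ultimately show thesis using that v' by blast
    qed
    have "push \<phi> (push fst (v - v'')) \<in> G"
      using G v''(4) by (simp add: push_diff)
    then show ?thesis
      using Glues_lift_step[OF _ liftM liftM' v v''(1,2,3), of geqP] compat v''(4)
      unfolding c comp_def by (smt (verit))
  qed
  then show ?thesis
    unfolding is_lift_def using Glues_subset_zvecs by blast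
qed

end
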